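(* Let $0<\alpha<1$, $\sigma_0>0$, $\theta>1$ and $N>0$ be real numbers, and suppose $\sigma_n^2=\sigma_0^2n^{-\theta}$. Let $$n_*=\left(\frac{9(\theta-1)^2\,\sigma_0^2\,N}{2\log(2/\alpha)}\right)^{1/(\theta+1)},$$ let $H_{\mathrm{MC}}=H^{\mathrm{Ben}}(1,N)$, let $H_{\mathrm{RQMC}}=H^{\mathrm{Ben}}(n_*,N/n_* )$, and let $N_\alpha=N/\log(2/\alpha)$. Then $$\frac{H_{\mathrm{RQMC}}}{H_{\mathrm{MC}}}=\frac{\theta+1}{\sqrt{2\sigma_0^2N_\alpha}+1/3}\left(\frac12\,[3(\theta-1)]^{1-\theta}\,N_\alpha\,\sigma_0^2\right)^{1/(\theta+1)},$$ and, with $\alpha,\sigma_0,\theta$ fixed, this ratio is $\Theta\bigl(N^{\frac{1-\theta}{2\theta+2}}\bigr)$ as $N\to\infty$.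
   Context: For real $n>0$ and $R>0$, the Bennett half width at confidence level $1-\alpha$, for $R$ independent identically distributed observations with values in $[0,1]$ each with variance $\sigma_n^2$, is $$H^{\mathrm{Ben}}(n,R)=\sqrt{\frac{2\sigma_n^2\log(2/\alpha)}{R}}+\frac{\log(2/\alpha)}{3R}.$$ The sample size $n$ is treated as a continuous positive variable and $R=N/n$ need not be an integer. The variance is modeled as $\sigma_n^2=\sigma_0^2n^{-\theta}$, where $\sigma_0$ and $\theta$ do not depend on $n$ or $N$. Here $\log$ is the natural logarithm. Notation: $a_N=O(b_N)$ as $N\to\infty$ means there exist $C>0$ and $N_0<\infty$ with $|a_N|\leqslant Cb_N$ whenever $N\geqslant N_0$; $a_N=\Theta(b_N)$ means $a_N=O(b_N)$ and $b_N=O(a_N)$. *)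

theory Defs
  imports Complex_Main "HOL-Library.Landau_Symbols"
begin

text \<open>
  The variance model is an arbitrary function \<open>\<sigma>sq\<close> giving the variance at sample size \<open>n\<close>.
  Sample sizes \<open>n\<close> and replicate counts \<open>R\<close> are positive reals.
\<close>

definition bennett_half_width :: "real \<Rightarrow> (real \<Rightarrow> real) \<Rightarrow> real \<Rightarrow> real \<Rightarrow> real" where
  "bennett_half_width \<alpha> \<sigma>sq n R =
     sqrt (2 * \<sigma>sq n * ln (2 / \<alpha>) / R) + ln (2 / \<alpha>) / (3 * R)"

definition n_star :: "real \<Rightarrow> real \<Rightarrow> real \<Rightarrow> real \<Rightarrow> real" where
  "n_star \<alpha> \<sigma>\<^sub>0 \<theta> N =
     (9 * (\<theta> - 1)\<^sup>2 * \<sigma>\<^sub>0\<^sup>2 * N / (2 * ln (2 / \<alpha>))) powr (1 / (\<theta> + 1))"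

definition N_alpha :: "real \<Rightarrow> real \<Rightarrow> real" where
  "N_alpha \<alpha> N = N / ln (2 / \<alpha>)"

definition H_MC :: "real \<Rightarrow> (real \<Rightarrow> real) \<Rightarrow> real \<Rightarrow> real" where
  "H_MC \<alpha> \<sigma>sq N = bennett_half_width \<alpha> \<sigma>sq 1 N"

definition H_RQMC :: "real \<Rightarrow> (real \<Rightarrow> real) \<Rightarrow> real \<Rightarrow> real \<Rightarrow> real \<Rightarrow> real" where
  "H_RQMC \<alpha> \<sigma>sq \<sigma>\<^sub>0 \<theta> N =
     bennett_half_width \<alpha> \<sigma>sq (n_star \<alpha> \<sigma>\<^sub>0 \<theta> N) (N / n_star \<alpha> \<sigma>\<^sub>0 \<theta> N)"

end

theory Submission
  imports Defs "HOL-Real_Asymp.Real_Asymp"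
begin

text \<open>
  With \<open>M = N / ln (2 / \<alpha>)\<close>, the definition of \<open>n = n_star\<close> amounts to
  \<open>n\<^bsup>\<theta>+1\<^esup> = 9 (\<theta> - 1)\<^sup>2 \<sigma>\<^sub>0\<^sup>2 M / 2\<close>. Since \<open>n\<^bsup>1-\<theta>\<^esup> = n\<^sup>2 / n\<^bsup>\<theta>+1\<^esup>\<close>, the radicand
  of the RQMC half width is a perfect square, and both of its terms are multiples of \<open>n / M\<close>.
  The growth rate is then read off the closed form of the ratio.
\<close>

text \<open>Both terms are put over the common denominator \<open>N_alpha\<close>, the one that also
  appears in the RQMC half width, so it cancels in the ratio.\<close>

lemma H_MC_eq:
  assumes "ln (2 / \<alpha>) > 0" and "N > 0" and "\<sigma>sq 1 = s\<^sup>2"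
  shows "H_MC \<alpha> \<sigma>sq N = (sqrt (2 * s\<^sup>2 * N_alpha \<alpha> N) + 1 / 3) / N_alpha \<alpha> N"
proof -
  define M where "M = N_alpha \<alpha> N"
  have M: "M > 0" "1 / M = ln (2 / \<alpha>) / N"
    using assms by (auto simp: M_def N_alpha_def)
  have "sqrt (2 * s\<^sup>2 * ln (2 / \<alpha>) / N) = sqrt (2 * s\<^sup>2 * M / M\<^sup>2)"
    using M by (simp add: M_def N_alpha_def field_simps power2_eq_square)
  also have "\<dots> = sqrt (2 * s\<^sup>2 * M) / M"
    using M by (simp add: real_sqrt_divide)
  finally show ?thesis
    using M assms unfolding H_MC_def bennett_half_width_def M_def[symmetric]
    by (simp add: add_divide_distrib)
qed

text \<open>The factor \<open>n_star\<close> is left unexpanded: once the square root is resolved,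
  the half width is linear in it.\<close>

lemma H_RQMC_eq:
  assumes L: "ln (2 / \<alpha>) > 0" and N: "N > 0" and s: "s > 0" and \<theta>: "\<theta> > 1"
    and var: "\<And>n. n > 0 \<Longrightarrow> \<sigma>sq n = s\<^sup>2 * n powr (- \<theta>)"
  shows "H_RQMC \<alpha> \<sigma>sq s \<theta> N =
    (\<theta> + 1) * n_star \<alpha> s \<theta> N / (3 * (\<theta> - 1) * N_alpha \<alpha> N)"
proof -
  define M where "M = N_alpha \<alpha> N"
  define n where "n = n_star \<alpha> s \<theta> N"
  have M: "M > 0" "ln (2 / \<alpha>) / N = 1 / M"
    using L N by (auto simp: M_def N_alpha_def)
  have n: "n > 0" using assms by (auto simp: n_def n_star_def)
  have pow: "n powr (\<theta> + 1) = 9 * (\<theta> - 1)\<^sup>2 * s\<^sup>2 * M / 2"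
    using assms by (simp add: n_def n_star_def powr_powr M_def N_alpha_def field_simps)
  have "n powr (- \<theta>) * n * n powr (\<theta> + 1) = n\<^sup>2"
  proof -
    have "n powr (- \<theta>) * n powr 1 * n powr (\<theta> + 1) = n powr 2"
      by (simp only: powr_add[symmetric]) simp
    then show ?thesis using n by simp
  qed
  then have "n powr (- \<theta>) * n = n\<^sup>2 * 2 / (9 * (\<theta> - 1)\<^sup>2 * s\<^sup>2 * M)"
    using s \<theta> M(1) unfolding pow by (simp add: field_simps)
  moreover have "2 * \<sigma>sq n * ln (2 / \<alpha>) / (N / n) =
      2 * s\<^sup>2 * (n powr (- \<theta>) * n) * (ln (2 / \<alpha>) / N)"
    using var[OF n] by simp
  \<comment> \<open>The variance scale \<open>s\<close> cancels here and survives only inside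
    \<open>n\<close>; the square takes one factor \<open>1 / M\<close> from
    \<open>n powr (- \<theta>) * n\<close> and one from
    \<open>ln (2 / \<alpha>) / N\<close>.\<close>
  ultimately have "2 * \<sigma>sq n * ln (2 / \<alpha>) / (N / n) = (2 * n / (3 * (\<theta> - 1) * M))\<^sup>2"
    using s M by (simp add: power_mult_distrib power_divide power2_eq_square
        del: right_diff_distrib_numeral)
  then have "sqrt (2 * \<sigma>sq n * ln (2 / \<alpha>) / (N / n)) = 2 * n / (3 * (\<theta> - 1) * M)"
    using n \<theta> M by (simp add: real_sqrt_unique)
  moreover have "ln (2 / \<alpha>) / (3 * (N / n)) = n / (3 * M)"
    using L M N n by (simp add: M_def N_alpha_def)
  \<comment> \<open>The factor \<open>\<theta> + 1\<close> of the final formula arises as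
    \<open>2 + (\<theta> - 1)\<close>.\<close>
  moreover have "2 * n / (3 * (\<theta> - 1) * M) + n / (3 * M) = (\<theta> + 1) * n / (3 * (\<theta> - 1) * M)"
    using \<theta> M(1) by (simp add: field_simps)
  ultimately show ?thesis
    unfolding H_RQMC_def bennett_half_width_def n_def[symmetric] M_def[symmetric] by simp
qed

text \<open>With \<open>c = 3 * (\<theta> - 1)\<close>, the base of \<open>n_star\<close> contains
  \<open>c\<^sup>2\<close>. Dividing by \<open>c\<close> outside the root divides by
  \<open>c powr (\<theta> + 1)\<close> inside it, which leaves
  \<open>c powr (1 - \<theta>)\<close>.\<close>

lemma n_star_rescaled:
  assumes L: "ln (2 / \<alpha>) > 0" and N: "N > 0" and \<theta>: "\<theta> > 1"
  shows "n_star \<alpha> s \<theta> N / (3 * (\<theta> - 1)) =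
    (1 / 2 * (3 * (\<theta> - 1)) powr (1 - \<theta>) * N_alpha \<alpha> N * s\<^sup>2) powr (1 / (\<theta> + 1))"
proof -
  define c where "c = 3 * (\<theta> - 1)"
  have c: "c > 0" using \<theta> by (simp add: c_def)
  have M: "N_alpha \<alpha> N > 0" using L N by (simp add: N_alpha_def)
  have "c powr (1 - \<theta>) * c powr (\<theta> + 1) = c powr 2"
    by (simp only: powr_add[symmetric]) simp
  then have c2: "c powr (1 - \<theta>) * c powr (\<theta> + 1) = c\<^sup>2" using c by simp
  have "n_star \<alpha> s \<theta> N = (1 / 2 * c\<^sup>2 * N_alpha \<alpha> N * s\<^sup>2) powr (1 / (\<theta> + 1))"
    \<comment> \<open>The distributivity rules are removed so that \<open>3 * (\<theta> - 1)\<close>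
      stays a product and its square matches the 9 in \<open>n_star\<close>.\<close>
    by (simp add: n_star_def N_alpha_def c_def power_mult_distrib mult_ac
        del: right_diff_distrib_numeral left_diff_distrib_numeral)
  also have "\<dots> = ((1 / 2 * c powr (1 - \<theta>) * N_alpha \<alpha> N * s\<^sup>2) * c powr (\<theta> + 1)) powr (1 / (\<theta> + 1))"
    unfolding c2[symmetric] by (simp add: mult_ac)
  also have "\<dots> = (1 / 2 * c powr (1 - \<theta>) * N_alpha \<alpha> N * s\<^sup>2) powr (1 / (\<theta> + 1)) * c"
    using c M \<theta> by (subst powr_mult) (auto simp: powr_powr)
  finally show ?thesis using c unfolding c_def[symmetric] by simp
qed

text \<open>The constant \<open>D\<close> is negligible beside the growing square root, so the
  denominator contributes \<open>x powr (- 1 / 2)\<close>.\<close>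

lemma powr_over_sqrt_bigtheta:
  fixes A B C D p :: real
  assumes "A > 0" "B > 0" "C > 0"
  shows "(\<lambda>x. A / (sqrt (B * x) + D) * (C * x) powr p) \<in> \<Theta>(\<lambda>x. x powr (p - 1 / 2))"
  using assms by real_asymp

theorem theorem2:
  fixes \<alpha> \<sigma>\<^sub>0 \<theta> :: real and \<sigma>sq :: "real \<Rightarrow> real"
  assumes "0 < \<alpha>" and "\<alpha> < 1" and "\<sigma>\<^sub>0 > 0" and "\<theta> > 1"
    and "\<And>n. n > 0 \<Longrightarrow> \<sigma>sq n = \<sigma>\<^sub>0\<^sup>2 * n powr (- \<theta>)"
  shows "(\<forall>N>0.
           H_RQMC \<alpha> \<sigma>sq \<sigma>\<^sub>0 \<theta> N / H_MC \<alpha> \<sigma>sq N =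
             (\<theta> + 1) / (sqrt (2 * \<sigma>\<^sub>0\<^sup>2 * N_alpha \<alpha> N) + 1 / 3) *
             (1 / 2 * (3 * (\<theta> - 1)) powr (1 - \<theta>) * N_alpha \<alpha> N * \<sigma>\<^sub>0\<^sup>2) powr (1 / (\<theta> + 1)))
       \<and> (\<lambda>N. H_RQMC \<alpha> \<sigma>sq \<sigma>\<^sub>0 \<theta> N / H_MC \<alpha> \<sigma>sq N)
           \<in> \<Theta>[at_top](\<lambda>N. N powr ((1 - \<theta>) / (2 * \<theta> + 2)))"
proof -
  have L: "ln (2 / \<alpha>) > 0" using assms(1,2) by (intro ln_gt_zero) (simp add: field_simps)
  let ?M = "N_alpha \<alpha>" and ?ratio = "\<lambda>N. H_RQMC \<alpha> \<sigma>sq \<sigma>\<^sub>0 \<theta> N / H_MC \<alpha> \<sigma>sq N"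
  let ?p = "1 / (\<theta> + 1)" and ?k = "(3 * (\<theta> - 1)) powr (1 - \<theta>)"
  have ratio: "?ratio N = (\<theta> + 1) / (sqrt (2 * \<sigma>\<^sub>0\<^sup>2 * ?M N) + 1 / 3) *
      (1 / 2 * ?k * ?M N * \<sigma>\<^sub>0\<^sup>2) powr ?p" if N: "N > 0" for N
  proof -
    have M: "?M N > 0" using L N by (simp add: N_alpha_def)
    then have "sqrt (2 * \<sigma>\<^sub>0\<^sup>2 * ?M N) + 1 / 3 > 0" by (intro add_nonneg_pos) auto
    then show ?thesis
      \<comment> \<open>Folding the closed form back into \<open>n_star\<close> leaves only a
        rational identity, in which \<open>N_alpha\<close> cancels.\<close>
      unfolding n_star_rescaled[OF L N assms(4), symmetric]
      using M assms(4) H_RQMC_eq[where \<sigma>sq = \<sigma>sq, OF L N assms(3-5)]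
      by (simp add: H_MC_eq[OF L N, of _ \<sigma>\<^sub>0] assms(5))
  qed
  let ?L = "ln (2 / \<alpha>)"
  let ?f = "\<lambda>N. (\<theta> + 1) / (sqrt (2 * \<sigma>\<^sub>0\<^sup>2 / ?L * N) + 1 / 3) *
      (1 / 2 * ?k * \<sigma>\<^sub>0\<^sup>2 / ?L * N) powr ?p"
  \<comment> \<open>The closed form is available only for positive \<open>N\<close>, which suffices
    at infinity; \<open>?f\<close> isolates \<open>N\<close> as a linear factor to fit the
    asymptotic lemma with \<open>D = 1 / 3\<close>.\<close>
  have "\<forall>\<^sub>F N in at_top. ?ratio N = ?f N"
    using eventually_gt_at_top[of 0]
    by eventually_elim (subst ratio, simp_all add: N_alpha_def mult_ac)
  then have "?ratio \<in> \<Theta>(\<lambda>N. N powr (?p - 1 / 2)) \<longleftrightarrow> ?f \<in> \<Theta>(\<lambda>N. N powr (?p - 1 / 2))"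
    by (rule landau_theta.in_cong)
  moreover have "?f \<in> \<Theta>(\<lambda>N. N powr (?p - 1 / 2))"
    using L assms(3,4) by (intro powr_over_sqrt_bigtheta) auto
  moreover have "?p - 1 / 2 = (1 - \<theta>) / (2 * \<theta> + 2)"
    using assms(4) by (simp add: field_simps)
  ultimately have "?ratio \<in> \<Theta>(\<lambda>N. N powr ((1 - \<theta>) / (2 * \<theta> + 2)))"
    by simp
  with ratio show ?thesis by blast
qed

end
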